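(* Let $J_T$ be an arbitrary period-$T$ Jacobi operator and $\{\lambda_i\}_{i=2}^\infty$ a sequence of numbers belonging to $\sigma_{ell}(J_T)$ such that every collection $\{\pi,\theta(\lambda_2),\theta(\lambda_3),\dots,\theta(\lambda_n)\}$, $n\ge 2$, is rationally independent. Let $\lambda_1\in\sigma_{ell}(J_T)$ be such that $\theta(\lambda_1)=\frac{p\pi}{q}\neq\frac{\pi}{2}$ with $p,q\in\mathbb{N}$, $\gcd(p,q)=1$. Then for any positive sequence $K(n)$ with $K(n)\to\infty$ (arbitrarily slowly) as $n\to\infty$, there exist a real sequence (potential) $(q_n)_{n\ge1}$ with $|q_n|\leq\frac{K(n)}{n}$ for all $n$, and, for every $i\geq 1$, a non-zero vector $(u_{n,i})_{n\geq 1}\in l^2(\mathbb{N};\mathbb{R})$, such that $$(J_T+Q)(u_{n,i})_{n\geq 1}=\lambda_i(u_{n,i})_{n\geq 1}\quad\text{for all } i\ge 1,$$ where $Q$ is the infinite diagonal matrix with entries $(q_n)$.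
   Context: A period-$T$ Jacobi operator $J_T$ ($T\in\mathbb{N}$) is the operator on $l^2(\mathbb{N})$ given by the tridiagonal symmetric matrix with diagonal entries $b_1,b_2,\dots$ and off-diagonal entries $a_1,a_2,\dots$, where $(a_n)$ and $(b_n)$ are $T$-periodic, $a_n,b_n\in\mathbb{R}$ and $a_n>0$; that is, $(J_Tu)_1=b_1u_1+a_1u_2$ and $(J_Tu)_n=a_{n-1}u_{n-1}+b_nu_n+a_nu_{n+1}$ for $n\ge 2$. The transfer matrices are $$B_i(\lambda)=\begin{pmatrix}0&1\\-\frac{a_{i-1}}{a_i}&\frac{\lambda-b_i}{a_i}\end{pmatrix},\quad i\in\{1,\dots,T\},\ a_0:=a_T,$$ and the monodromy matrix is $M(\lambda)=B_T(\lambda)\cdots B_1(\lambda)$. The generalised interior of the essential spectrum is $\sigma_{ell}(J_T)=\{\lambda\in\mathbb{R} : |\operatorname{Tr}M(\lambda)|<2\}$. For $\lambda\in\sigma_{ell}(J_T)$ the eigenvalues of $M(\lambda)$ are $e^{\pm i\theta(\lambda)}$ with $\theta(\lambda)\in(0,\pi)$; $\theta(\lambda)$ is called the quasi-momentum. A finite collection of real numbers is rationally independent if it is linearly independent over $\mathbb{Q}$. *)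

theory Defs
  imports "HOL-Analysis.Analysis"
begin

text \<open>
  Sequences indexed by the positive integers are functions on \<^typ>\<open>nat\<close> whose value
  at \<open>0\<close> is never inspected.
\<close>

definition jacobi_parameters :: "nat \<Rightarrow> (nat \<Rightarrow> real) \<Rightarrow> (nat \<Rightarrow> real) \<Rightarrow> bool" where
  "jacobi_parameters T a b \<longleftrightarrow>
     T \<ge> 1 \<and> (\<forall>n\<ge>1. a n > 0 \<and> a (n + T) = a n \<and> b (n + T) = b n)"

definition jacobi_op :: "(nat \<Rightarrow> real) \<Rightarrow> (nat \<Rightarrow> real) \<Rightarrow> (nat \<Rightarrow> real) \<Rightarrow> nat \<Rightarrow> real" where
  "jacobi_op a b u n =
     (if n = 1 then b 1 * u 1 + a 1 * u 2
      else a (n - 1) * u (n - 1) + b n * u n + a n * u (n + 1))"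

definition diag_op :: "(nat \<Rightarrow> real) \<Rightarrow> (nat \<Rightarrow> real) \<Rightarrow> nat \<Rightarrow> real" where
  "diag_op q u n = q n * u n"

definition l2_seq :: "(nat \<Rightarrow> real) set" where
  "l2_seq = {u. (\<lambda>n. (u n)\<^sup>2) summable_on {1..}}"

text \<open>The conditional implements the convention \<open>a\<^sub>0 = a\<^sub>T\<close>.\<close>

definition transfer_matrix ::
    "nat \<Rightarrow> (nat \<Rightarrow> real) \<Rightarrow> (nat \<Rightarrow> real) \<Rightarrow> real \<Rightarrow> nat \<Rightarrow> real^2^2" where
  "transfer_matrix T a b x i =
     vector [vector [0, 1],
             vector [- (if i = 1 then a T else a (i - 1)) / a i, (x - b i) / a i]]"

primrec transfer_product ::
    "nat \<Rightarrow> (nat \<Rightarrow> real) \<Rightarrow> (nat \<Rightarrow> real) \<Rightarrow> real \<Rightarrow> nat \<Rightarrow> real^2^2" where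
  "transfer_product T a b x 0 = mat 1"
| "transfer_product T a b x (Suc k) =
     transfer_matrix T a b x (Suc k) ** transfer_product T a b x k"

definition monodromy :: "nat \<Rightarrow> (nat \<Rightarrow> real) \<Rightarrow> (nat \<Rightarrow> real) \<Rightarrow> real \<Rightarrow> real^2^2" where
  "monodromy T a b x = transfer_product T a b x T"

definition sigma_ell :: "nat \<Rightarrow> (nat \<Rightarrow> real) \<Rightarrow> (nat \<Rightarrow> real) \<Rightarrow> real set" where
  "sigma_ell T a b = {x. \<bar>trace (monodromy T a b x)\<bar> < 2}"

definition complex_eigenvalues :: "real^'n^'n \<Rightarrow> complex set" where
  "complex_eigenvalues A =
     {z. \<exists>v. v \<noteq> 0 \<and> (\<chi> i j. complex_of_real (A $ i $ j)) *v v = z *s v}"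

text \<open>Only meaningful on \<open>sigma_ell T a b\<close>; see \<open>quasi_momentum_unique\<close> below.\<close>

definition quasi_momentum :: "nat \<Rightarrow> (nat \<Rightarrow> real) \<Rightarrow> (nat \<Rightarrow> real) \<Rightarrow> real \<Rightarrow> real" where
  "quasi_momentum T a b x =
     (THE t. 0 < t \<and> t < pi \<and> complex_eigenvalues (monodromy T a b x) = {cis t, cis (- t)})"

text \<open>
  A list, not a set, because a collection with a repeated member is dependent.
\<close>

definition rationally_independent :: "real list \<Rightarrow> bool" where
  "rationally_independent xs \<longleftrightarrow>
     distinct xs \<and> module.independent (\<lambda>(r::rat) x. of_rat r * x) (set xs)"

lemma det_transfer_product:
  assumes "jacobi_parameters T a b" "k \<ge> 1"
  shows "det (transfer_product T a b x k) = a T / a k"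
  using assms(2)
proof (induction k rule: dec_induct)
  case base
  have "a 1 > 0" using assms by (auto simp: jacobi_parameters_def)
  then show ?case by (simp add: transfer_matrix_def det_2)
next
  case (step k)
  have "a k > 0" "a (Suc k) > 0" using assms step by (auto simp: jacobi_parameters_def)
  then show ?case using step by (simp add: det_mul) (simp add: transfer_matrix_def det_2)
qed

lemma det_monodromy:
  assumes "jacobi_parameters T a b"
  shows "det (monodromy T a b x) = 1"
proof -
  have T: "T \<ge> 1" "a T > 0" using assms by (auto simp: jacobi_parameters_def)
  show ?thesis using det_transfer_product[OF assms T(1)] T by (simp add: monodromy_def)
qed

lemma complex_eigenvalues_2:
  fixes A :: "real^2^2"
  shows "complex_eigenvalues A = {z. z\<^sup>2 - of_real (trace A) * z + of_real (det A) = 0}"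
proof -
  define B :: "complex^2^2" where "B = (\<chi> i j. complex_of_real (A $ i $ j))"
  have "z \<in> complex_eigenvalues A \<longleftrightarrow> z\<^sup>2 - of_real (trace A) * z + of_real (det A) = 0" for z
  proof -
    have "z \<in> complex_eigenvalues A \<longleftrightarrow> (\<exists>v. v \<noteq> 0 \<and> (B - mat z) *v v = 0)"
    proof -
      have "mat z *v v = z *s v" for v :: "complex^2"
        by (simp add: vec_eq_iff matrix_vector_mult_def mat_def forall_2 sum_2)
      then show ?thesis
        by (simp add: complex_eigenvalues_def B_def matrix_vector_mult_diff_rdistrib)
    qed
    also have "\<dots> \<longleftrightarrow> det (B - mat z) = 0"
      using invertible_det_nz[of "B - mat z"] matrix_left_invertible_ker[of "B - mat z"]
        invertible_left_inverse[of "B - mat z"] by blast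
    also have "det (B - mat z) = z\<^sup>2 - of_real (trace A) * z + of_real (det A)"
      by (simp add: det_2 trace_def sum_2 B_def mat_def power2_eq_square algebra_simps)
    finally show ?thesis .
  qed
  then show ?thesis by auto
qed

lemma quasi_momentum_unique:
  assumes "jacobi_parameters T a b" "x \<in> sigma_ell T a b"
  shows "\<exists>!t. 0 < t \<and> t < pi \<and> complex_eigenvalues (monodromy T a b x) = {cis t, cis (- t)}"
proof -
  define c where "c = trace (monodromy T a b x) / 2"
  have c: "-1 < c" "c < 1" using assms(2) by (auto simp: sigma_ell_def c_def abs_less_iff)
  have ev: "complex_eigenvalues (monodromy T a b x) = {z. z\<^sup>2 - of_real (2 * c) * z + 1 = 0}"
    using complex_eigenvalues_2[of "monodromy T a b x"] det_monodromy[OF assms(1)]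
    by (simp add: c_def)
  have cis: "{z. z\<^sup>2 - of_real (2 * cos t) * z + 1 = 0} = {cis t, cis (- t)}" for t
  proof -
    have s: "cis t + cis (- t) = of_real (2 * cos t)" and p: "cis t * cis (- t) = 1"
      by (simp_all add: complex_eq_iff cis_mult)
    have "z\<^sup>2 - of_real (2 * cos t) * z + 1 = (z - cis t) * (z - cis (- t))" for z
    proof -
      have "(z - cis t) * (z - cis (- t)) = z\<^sup>2 - (cis t + cis (- t)) * z + cis t * cis (- t)"
        by (simp add: power2_eq_square algebra_simps)
      then show ?thesis unfolding s p by simp
    qed
    then show ?thesis by auto
  qed
  show ?thesis
  proof (rule ex1I)
    show "0 < arccos c \<and> arccos c < pi \<and>
        complex_eigenvalues (monodromy T a b x) = {cis (arccos c), cis (- arccos c)}"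
      using c cis[of "arccos c"] ev by (simp add: arccos_lt_bounded)
  next
    fix t
    assume t: "0 < t \<and> t < pi \<and> complex_eigenvalues (monodromy T a b x) = {cis t, cis (- t)}"
    then have "cis (arccos c) \<in> {cis t, cis (- t)}"
      using c cis[of "arccos c"] ev by auto
    then have "c = cos t" using c by (auto simp: complex_eq_iff)
    then show "t = arccos c" using t by (simp add: arccos_cos)
  qed
qed

end

theory Submission
  imports Defs
begin

text \<open>
  Put the potential on the multiples of the period only, with the value \<open>t k\<close> at \<open>Suc k * T\<close>. For an
  eigenvalue parameter in the elliptic set the monodromy matrix is conjugate to a rotation, and in
  a suitable complex coordinate \<open>z\<close> of the solution over one period the eigenvalue equation becomes
  \<open>z (k + 1) = cis \<eta> * (z k - \<kappa> t k Im (z k))\<close> with \<open>\<kappa> > 0\<close> and \<open>\<eta>\<close> equal to the quasi-momentum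
  \<open>\<theta>\<close> up to sign (lemmas \<open>elliptic_coordinate\<close> and \<open>solution_vector_period\<close>). One step changes
  \<open>ln |z|\<^sup>2\<close> by \<open>- \<kappa> t k sin (2 arg z)\<close> up to an error of order \<open>(t k)\<^sup>2\<close> (\<open>shear_step\<close>).

  This suggests a feedback: let \<open>t k\<close> be the sum over the eigenvalues \<open>j\<close> of
  \<open>c j / (k + 1) * sin (2 arg (z j))\<close>, evaluated at the current solutions \<open>z j\<close>. In the growth
  exponent of the solution number \<open>i\<close> there appear the products
  \<open>sin (2 arg (z i)) * sin (2 arg (z j))\<close>. As all arguments advance by almost constant steps, such a
  product has mean \<open>1/2\<close> for \<open>i = j\<close> and mean \<open>0\<close> otherwise, unless one of the rotations by
  \<open>2 (\<theta> i + \<theta> j)\<close> or, for \<open>i \<noteq> j\<close>, by \<open>2 (\<theta> i - \<theta> j)\<close> is trivial (\<open>sine_correlation_bound\<close>). The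
  arithmetic hypotheses exclude exactly this (\<open>no_resonance\<close>): rational independence,
  together with the rationality of the exceptional \<open>\<theta> / pi\<close>, deals with all pairs except the
  exceptional index paired with itself, where \<open>\<theta> \<noteq> pi / 2\<close> is needed. Weighted with
  \<open>1 / (k + 1)\<close> the mean value diverges like \<open>ln n\<close> while the oscillating parts have bounded sums, so
  a large enough \<open>c i\<close> makes \<open>|z i|\<close> decay at least as fast as \<open>1 / n\<close>.

  Infinitely many eigenvalues are treated by switching on their feedback terms one after the other
  (\<open>switch_on_times_exist\<close>). Since \<open>K\<close> tends to infinity, it eventually exceeds any finite sum of
  the amplitudes \<open>c j\<close>, and a sufficiently late start keeps the disturbance of all earlier solutions
  below a geometric series. This is the content of \<open>simultaneous_decay_control\<close>.
\<close>

section \<open>Sums along near rotations\<close>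

text \<open>
  If \<open>P (Suc k) = \<omega> P k\<close> held exactly, then \<open>P k = (P (Suc k) - P k) / (\<omega> - 1)\<close> and the sum
  would be summed by parts; the defects \<open>\<delta>\<close> enter additively. The factor \<open>norm (\<omega> - 1)\<close>
  stays on the left so that \<open>\<omega> = 1\<close> causes no division by zero.
\<close>
lemma oscillating_sum_bound:
  fixes P :: "nat \<Rightarrow> complex" and \<epsilon> \<delta> :: "nat \<Rightarrow> real"
  assumes P: "\<And>k. norm (P k) \<le> 1"
    and step: "\<And>k. norm (P (Suc k) - \<omega> * P k) \<le> \<delta> k"
    and nonneg: "\<And>k. \<epsilon> k \<ge> 0" and dec: "\<And>k. \<epsilon> (Suc k) \<le> \<epsilon> k"
    and mn: "m \<le> n"
  shows "norm (\<omega> - 1) * norm (\<Sum>k=m..<n. of_real (\<epsilon> k) * P k)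
           \<le> 2 * \<epsilon> m + (\<Sum>k=m..<n. \<epsilon> k * \<delta> k)"
proof -
  define A where "A n = (\<Sum>k=m..<n. of_real (\<epsilon> k) * (P (Suc k) - P k))" for n
  define E where "E = (\<Sum>k=m..<n. of_real (\<epsilon> k) * (P (Suc k) - \<omega> * P k))"
  \<comment> \<open>Subtracting the boundary term makes the partial sums telescope with total weight
      \<open>\<epsilon> m + (\<epsilon> m - \<epsilon> n)\<close>.\<close>
  have "norm (A n - of_real (\<epsilon> n) * P n) \<le> 2 * \<epsilon> m - \<epsilon> n"
    using mn
  proof (induction n rule: dec_induct)
    case base
    show ?case using mult_left_mono[OF P[of m] nonneg[of m]] nonneg[of m]
      by (simp add: A_def norm_mult)
  next
    case (step n)
    have "A (Suc n) - of_real (\<epsilon> (Suc n)) * P (Suc n)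
        = (A n - of_real (\<epsilon> n) * P n) + of_real (\<epsilon> n - \<epsilon> (Suc n)) * P (Suc n)"
      using step by (simp add: A_def algebra_simps)
    also have "norm \<dots> \<le> (2 * \<epsilon> m - \<epsilon> n) + (\<epsilon> n - \<epsilon> (Suc n)) * 1"
      using step dec[of n] P[of "Suc n"]
      by (intro norm_triangle_mono) (auto simp: norm_mult simp del: of_real_diff intro!: mult_left_le)
    finally show ?case by simp
  qed
  moreover have "norm (of_real (\<epsilon> n) * P n) \<le> \<epsilon> n"
    using mult_left_mono[OF P[of n] nonneg[of n]] nonneg[of n] by (simp add: norm_mult)
  ultimately have A: "norm (A n) \<le> 2 * \<epsilon> m"
    using norm_triangle_sub[of "A n" "of_real (\<epsilon> n) * P n"] by linarith
  have "norm E \<le> (\<Sum>k=m..<n. \<epsilon> k * \<delta> k)"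
    unfolding E_def
    by (intro sum_norm_le) (auto simp: norm_mult nonneg intro!: mult_left_mono step)
  moreover have "(\<omega> - 1) * (\<Sum>k=m..<n. of_real (\<epsilon> k) * P k) = A n - E"
    unfolding A_def E_def sum_distrib_left sum_subtractf[symmetric]
    by (intro sum.cong) (auto simp: algebra_simps)
  ultimately have "norm ((\<omega> - 1) * (\<Sum>k=m..<n. of_real (\<epsilon> k) * P k))
      \<le> 2 * \<epsilon> m + (\<Sum>k=m..<n. \<epsilon> k * \<delta> k)"
    using A norm_triangle_ineq4[of "A n" E] by simp
  then show ?thesis by (simp add: norm_mult)
qed

text \<open>
  The defect is measured against a control sequence \<open>t\<close> because the perturbation alone makes the
  phases deviate from a rigid rotation.
\<close>
definition near_rotation :: "real \<Rightarrow> real \<Rightarrow> (nat \<Rightarrow> real) \<Rightarrow> (nat \<Rightarrow> complex) \<Rightarrow> bool" where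
  "near_rotation \<alpha> C t W \<longleftrightarrow>
     (\<forall>k. norm (W k) = 1 \<and> norm (W (Suc k) - cis \<alpha> * W k) \<le> C * \<bar>t k\<bar>)"

lemma near_rotation_cnj:
  assumes "near_rotation \<alpha> C t W"
  shows "near_rotation (- \<alpha>) C t (\<lambda>k. cnj (W k))"
proof -
  have "norm (cnj (W (Suc k)) - cis (- \<alpha>) * cnj (W k)) = norm (W (Suc k) - cis \<alpha> * W k)" for k
  proof -
    have "cnj (W (Suc k)) - cis (- \<alpha>) * cnj (W k) = cnj (W (Suc k) - cis \<alpha> * W k)"
      by (simp add: cis_cnj)
    then show ?thesis by (simp only: complex_mod_cnj)
  qed
  then show ?thesis using assms by (simp add: near_rotation_def)
qed

lemma near_rotation_mult:
  assumes V: "near_rotation \<alpha> C t V" and W: "near_rotation \<beta> D t W"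
  shows "near_rotation (\<alpha> + \<beta>) (C + D) t (\<lambda>k. V k * W k)"
  unfolding near_rotation_def
proof (intro allI conjI)
  fix k
  show "norm (V k * W k) = 1" using V W by (simp add: near_rotation_def norm_mult)
  have "V (Suc k) * W (Suc k) - cis (\<alpha> + \<beta>) * (V k * W k)
      = (V (Suc k) - cis \<alpha> * V k) * W (Suc k) + cis \<alpha> * V k * (W (Suc k) - cis \<beta> * W k)"
    by (simp add: cis_mult[symmetric] algebra_simps)
  also have "norm \<dots> \<le> C * \<bar>t k\<bar> + D * \<bar>t k\<bar>"
    using V W by (intro norm_triangle_mono) (auto simp: near_rotation_def norm_mult)
  finally show "norm (V (Suc k) * W (Suc k) - cis (\<alpha> + \<beta>) * (V k * W k)) \<le> (C + D) * \<bar>t k\<bar>"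
    by (simp add: algebra_simps)
qed

lemma near_rotation_sum_bound:
  assumes P: "near_rotation \<alpha> C t P" and \<alpha>: "cis \<alpha> \<noteq> 1" and C: "C \<ge> 0"
    and nonneg: "\<And>k. \<epsilon> k \<ge> 0" and dec: "\<And>k. \<epsilon> (Suc k) \<le> \<epsilon> k" and mn: "m \<le> n"
  shows "\<bar>\<Sum>k=m..<n. \<epsilon> k * Re (P k)\<bar>
           \<le> (2 + C) / norm (cis \<alpha> - 1) * (\<epsilon> m + (\<Sum>k=m..<n. \<epsilon> k * \<bar>t k\<bar>))"
proof -
  define N where "N = norm (cis \<alpha> - 1)"
  have N: "N > 0" using \<alpha> by (simp add: N_def)
  define S where "S = (\<Sum>k=m..<n. \<epsilon> k * \<bar>t k\<bar>)"
  have S: "S \<ge> 0" unfolding S_def by (intro sum_nonneg) (simp add: nonneg)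
  have "(\<Sum>k=m..<n. \<epsilon> k * Re (P k)) = Re (\<Sum>k=m..<n. of_real (\<epsilon> k) * P k)"
    by simp
  then have "N * \<bar>\<Sum>k=m..<n. \<epsilon> k * Re (P k)\<bar> \<le> N * norm (\<Sum>k=m..<n. of_real (\<epsilon> k) * P k)"
    using N abs_Re_le_cmod[of "\<Sum>k=m..<n. of_real (\<epsilon> k) * P k"] by simp
  also have "\<dots> \<le> 2 * \<epsilon> m + (\<Sum>k=m..<n. \<epsilon> k * (C * \<bar>t k\<bar>))"
    unfolding N_def using P
    by (intro oscillating_sum_bound nonneg dec mn) (auto simp: near_rotation_def)
  also have "(\<Sum>k=m..<n. \<epsilon> k * (C * \<bar>t k\<bar>)) = C * S"
    by (simp add: S_def sum_distrib_left algebra_simps)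
  also have "2 * \<epsilon> m + C * S \<le> (2 + C) * (\<epsilon> m + S)"
    using S C nonneg[of m] by (simp add: algebra_simps)
  finally show ?thesis using N by (simp add: N_def[symmetric] S_def[symmetric] field_simps)
qed

text \<open>
  The product \<open>Im v * Im w\<close> equals \<open>(Re (v * cnj w) - Re (v * w)) / 2\<close>. Both products are again near
  rotations, by the difference and the sum of the angles, so they average out; for a single phase
  the first product is constantly \<open>1\<close> and leaves the mean value \<open>1/2\<close>. The constant \<open>B\<close> is
  independent of the control \<open>t\<close>: it has to be known before the control is designed.
\<close>
lemma sine_correlation_bound:
  assumes sum: "cis (\<alpha> + \<beta>) \<noteq> 1" and diff: "\<not> same \<Longrightarrow> cis (\<alpha> - \<beta>) \<noteq> 1"
    and "C \<ge> 0" "D \<ge> 0"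
  shows "\<exists>B\<ge>0. \<forall>t V W \<epsilon> m n.
     near_rotation \<alpha> C t V \<and> near_rotation \<beta> D t W \<and> (same \<longrightarrow> V = W) \<and>
     (\<forall>k. \<epsilon> k \<ge> 0 \<and> \<epsilon> (Suc k) \<le> \<epsilon> k) \<and> m \<le> n \<longrightarrow>
     \<bar>\<Sum>k=m..<n. \<epsilon> k * (Im (V k) * Im (W k) - (if same then 1/2 else 0))\<bar>
       \<le> B * (\<epsilon> m + (\<Sum>k=m..<n. \<epsilon> k * \<bar>t k\<bar>))"
proof -
  define B where "B \<gamma> = (2 + (C + D)) / norm (cis \<gamma> - 1)" for \<gamma>
  have B: "B \<gamma> \<ge> 0" for \<gamma> using assms(3,4) by (simp add: B_def)
  show ?thesis
  proof (intro exI[of _ "B (\<alpha> + \<beta>) + B (\<alpha> - \<beta>)"] conjI allI impI)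
    show "0 \<le> B (\<alpha> + \<beta>) + B (\<alpha> - \<beta>)" using B by (simp add: add_nonneg_nonneg)
  next
    fix t V W \<epsilon> and m n :: nat
    assume *: "near_rotation \<alpha> C t V \<and> near_rotation \<beta> D t W \<and> (same \<longrightarrow> V = W) \<and>
      (\<forall>k. \<epsilon> k \<ge> 0 \<and> \<epsilon> (Suc k) \<le> (\<epsilon> k :: real)) \<and> m \<le> n"
    define L where "L = \<epsilon> m + (\<Sum>k=m..<n. \<epsilon> k * \<bar>t k\<bar>)"
    have L: "L \<ge> 0" unfolding L_def using * by (intro add_nonneg_nonneg sum_nonneg) auto
    define S1 where "S1 = (\<Sum>k=m..<n. \<epsilon> k * Re (V k * W k))"
    define S2 where "S2 = (if same then 0 else \<Sum>k=m..<n. \<epsilon> k * Re (V k * cnj (W k)))"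
    have V: "near_rotation \<alpha> C t V" and W: "near_rotation \<beta> D t W" using * by auto
    have b1: "\<bar>S1\<bar> \<le> B (\<alpha> + \<beta>) * L"
      unfolding S1_def B_def L_def using * assms
      by (intro near_rotation_sum_bound near_rotation_mult[OF V W]) auto
    have b2: "\<bar>S2\<bar> \<le> B (\<alpha> - \<beta>) * L"
    proof (cases same)
      case True
      then show ?thesis using B L by (simp add: S2_def)
    next
      case False
      have "near_rotation (\<alpha> - \<beta>) (C + D) t (\<lambda>k. V k * cnj (W k))"
        using near_rotation_mult[OF V near_rotation_cnj[OF W]] by simp
      then show ?thesis
        unfolding S2_def B_def L_def using * assms False
        by (simp only: if_False) (intro near_rotation_sum_bound, auto)
    qed
    have "\<epsilon> k * (Im (V k) * Im (W k) - (if same then 1/2 else 0))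
        = ((if same then 0 else \<epsilon> k * Re (V k * cnj (W k))) - \<epsilon> k * Re (V k * W k)) / 2" for k
    proof (cases same)
      case True
      then have eq: "W k = V k" using * by auto
      have "(Re (V k))\<^sup>2 + (Im (V k))\<^sup>2 = 1"
        using V by (simp add: near_rotation_def cmod_power2[symmetric])
      then have re: "Re (V k) * Re (V k) = 1 - Im (V k) * Im (V k)" by (simp add: power2_eq_square)
      show ?thesis using True by (simp add: eq re) (simp add: field_simps)
    next
      case False
      then show ?thesis by (simp add: algebra_simps)
    qed
    then have eq: "(\<lambda>k. \<epsilon> k * (Im (V k) * Im (W k) - (if same then 1/2 else 0)))
        = (\<lambda>k. ((if same then 0 else \<epsilon> k * Re (V k * cnj (W k))) - \<epsilon> k * Re (V k * W k)) / 2)"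
      by blast
    have "(\<Sum>k=m..<n. \<epsilon> k * (Im (V k) * Im (W k) - (if same then 1/2 else 0)))
        = (S2 - S1) / 2"
      unfolding eq S1_def S2_def
      by (simp add: sum_divide_distrib[symmetric] sum_subtractf)
    moreover have "\<bar>(S2 - S1) / 2\<bar> \<le> (B (\<alpha> + \<beta>) + B (\<alpha> - \<beta>)) * L"
      using b1 b2 by (simp add: algebra_simps)
    ultimately show "\<bar>\<Sum>k=m..<n. \<epsilon> k * (Im (V k) * Im (W k) - (if same then 1/2 else 0))\<bar>
       \<le> (B (\<alpha> + \<beta>) + B (\<alpha> - \<beta>)) * (\<epsilon> m + (\<Sum>k=m..<n. \<epsilon> k * \<bar>t k\<bar>))"
      unfolding L_def by simp
  qed
qed

section \<open>A rotation followed by a small shear\<close>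

lemma dist_sgn_le:
  fixes x y :: complex
  assumes "x \<noteq> 0"
  shows "norm (sgn y - sgn x) \<le> 2 * norm (y - x) / norm x"
proof (cases "y = 0")
  case True
  then show ?thesis using assms by (simp add: norm_sgn)
next
  case False
  have "sgn y - sgn x = sgn y * of_real ((norm x - norm y) / norm x) + (y - x) / of_real (norm x)"
    using assms False by (simp add: sgn_eq field_simps)
  also have "norm \<dots> \<le> norm (y - x) / norm x + norm (y - x) / norm x"
    using False norm_triangle_ineq3[of x y]
    by (intro norm_triangle_mono)
       (auto simp: norm_mult norm_sgn norm_divide norm_minus_commute simp del: of_real_diff of_real_divide intro!: divide_right_mono)
  finally show ?thesis by simp
qed

text \<open>
  The shear \<open>z \<mapsto> z - \<kappa> t Im z\<close> fixes the real axis, hence to first order it changes \<open>ln |z|\<^sup>2\<close> by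
  \<open>- 2 \<kappa> t Re z Im z / |z|\<^sup>2 = - \<kappa> t Im ((sgn z)\<^sup>2)\<close>: the sine of the doubled argument decides
  whether a positive \<open>t\<close> contracts or expands. The squared phase \<open>(sgn z)\<^sup>2\<close> is the natural variable
  and moves by a near rotation through \<open>2 \<eta>\<close>.
\<close>
lemma shear_step:
  fixes z :: complex
  assumes z: "z \<noteq> 0" and z': "z' = cis \<eta> * (z - of_real (\<kappa> * t * Im z))" and \<kappa>: "\<kappa> > 0"
  shows "z' \<noteq> 0"
    and "norm ((sgn z')\<^sup>2 - cis (2 * \<eta>) * (sgn z)\<^sup>2) \<le> 4 * \<kappa> * \<bar>t\<bar>"
    and "ln ((norm z')\<^sup>2) \<le> ln ((norm z)\<^sup>2) - \<kappa> * (t * Im ((sgn z)\<^sup>2)) + \<kappa>\<^sup>2 * t\<^sup>2"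
proof -
  define y where "y = z - of_real (\<kappa> * t * Im z)"
  have y: "y \<noteq> 0" using z by (auto simp: y_def complex_eq_iff)
  then show nz: "z' \<noteq> 0" using z' by (simp add: y_def)
  have dist: "norm (y - z) \<le> \<kappa> * \<bar>t\<bar> * norm z"
    using \<kappa> abs_Im_le_cmod[of z] by (simp add: y_def norm_mult abs_mult mult_left_mono)
  have "norm (sgn y - sgn z) \<le> 2 * (\<kappa> * \<bar>t\<bar> * norm z) / norm z"
    using dist_sgn_le[OF z, of y] dist
    by (smt (verit, best) divide_right_mono norm_ge_zero)
  then have s: "norm (sgn y - sgn z) \<le> 2 * \<kappa> * \<bar>t\<bar>" using z by simp
  have "sgn z' = cis \<eta> * sgn y" unfolding z' y_def[symmetric] sgn_mult by (simp add: sgn_eq)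
  moreover have double: "cis (2 * \<eta>) = cis \<eta> * cis \<eta>" by (simp add: cis_mult)
  ultimately have "(sgn z')\<^sup>2 - cis (2 * \<eta>) * (sgn z)\<^sup>2
      = cis (2 * \<eta>) * ((sgn y - sgn z) * (sgn y + sgn z))"
    by (simp add: double power2_eq_square algebra_simps)
  then have "norm ((sgn z')\<^sup>2 - cis (2 * \<eta>) * (sgn z)\<^sup>2) = norm (sgn y - sgn z) * norm (sgn y + sgn z)"
    by (simp add: norm_mult)
  also have "\<dots> \<le> (2 * \<kappa> * \<bar>t\<bar>) * 2"
    using s \<kappa> norm_triangle_ineq[of "sgn y" "sgn z"] y z
    by (intro mult_mono) (auto simp: norm_sgn)
  finally show "norm ((sgn z')\<^sup>2 - cis (2 * \<eta>) * (sgn z)\<^sup>2) \<le> 4 * \<kappa> * \<bar>t\<bar>" by simp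
  define r where "r = (norm z)\<^sup>2"
  have r: "r > 0" "r = (Re z)\<^sup>2 + (Im z)\<^sup>2" using z by (simp_all add: r_def) (simp add: cmod_power2)
  have ims: "Im ((sgn z)\<^sup>2) = 2 * Re z * Im z / r"
  proof -
    have "(sgn z)\<^sup>2 = z\<^sup>2 / of_real r" by (simp add: sgn_eq r_def power_divide)
    then show ?thesis by (simp add: Im_divide_of_real power2_eq_square algebra_simps)
  qed
  define \<rho> where "\<rho> = - \<kappa> * (t * Im ((sgn z)\<^sup>2)) + \<kappa>\<^sup>2 * t\<^sup>2 * ((Im z)\<^sup>2 / r)"
  have "(norm z')\<^sup>2 = (norm y)\<^sup>2" using z' by (simp add: y_def norm_mult)
  also have "\<dots> = r * (1 + \<rho>)"
    using r(1) unfolding cmod_power2 \<rho>_def ims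
    by (simp add: y_def field_simps) (simp add: r(2) power2_eq_square algebra_simps)
  finally have n: "(norm z')\<^sup>2 = r * (1 + \<rho>)" .
  then have "1 + \<rho> > 0" using nz r(1)
    by (metis zero_less_mult_pos zero_less_norm_iff zero_less_power)
  then have "ln ((norm z')\<^sup>2) \<le> ln r + \<rho>"
    using n r(1) ln_add_one_self_le_self2[of \<rho>] by (simp add: ln_mult)
  moreover have "\<kappa>\<^sup>2 * t\<^sup>2 * ((Im z)\<^sup>2 / r) \<le> \<kappa>\<^sup>2 * t\<^sup>2"
    using r by (intro mult_left_le) (auto simp: divide_le_eq)
  ultimately show "ln ((norm z')\<^sup>2) \<le> ln ((norm z)\<^sup>2) - \<kappa> * (t * Im ((sgn z)\<^sup>2)) + \<kappa>\<^sup>2 * t\<^sup>2"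
    unfolding \<rho>_def r_def by linarith
qed

section \<open>Steering all eigenvalues simultaneously\<close>

text \<open>
  The exponent may be anything strictly between \<open>- 1\<close> and \<open>- 1/2\<close>: the control, which is to be of
  size \<open>1 / k\<close> times a growing factor, must fit below the scale, and the squares of the scale
  must be summable.
\<close>
definition decay_scale :: "nat \<Rightarrow> real" where
  "decay_scale k = real (Suc k) powr (- 3 / 4)"

definition scale_tail :: "nat \<Rightarrow> real" where
  "scale_tail m = decay_scale m + (\<Sum>k. (decay_scale (k + m))\<^sup>2)"

lemma summable_decay_scale_sq: "summable (\<lambda>k. (decay_scale k)\<^sup>2)"
proof -
  have "(decay_scale k)\<^sup>2 = real (Suc k) powr (- 3 / 2)" for k
    by (simp add: decay_scale_def power2_eq_square powr_add[symmetric])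
  moreover have "summable (\<lambda>k. real (Suc k) powr (- 3 / 2))"
    by (subst summable_Suc_iff[of "\<lambda>k. real k powr (- 3 / 2)"], subst summable_real_powr_iff) simp
  ultimately show ?thesis by simp
qed

lemma scale_tail_tendsto_0: "scale_tail \<longlonglongrightarrow> 0"
proof -
  have "decay_scale \<longlonglongrightarrow> 0"
    unfolding decay_scale_def
    by (rule tendsto_neg_powr[OF _ filterlim_compose[OF filterlim_real_sequentially filterlim_Suc]]) simp
  moreover have "(\<lambda>m. \<Sum>k. (decay_scale (k + m))\<^sup>2) \<longlonglongrightarrow> 0"
    by (rule suminf_exist_split2[OF summable_decay_scale_sq])
  ultimately show ?thesis
    unfolding scale_tail_def using tendsto_add by fastforce
qed

lemma sum_decay_scale_sq_le: "(\<Sum>k=m..<n. (decay_scale k)\<^sup>2) \<le> (\<Sum>k. (decay_scale (k + m))\<^sup>2)"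
proof (cases "m \<le> n")
  case True
  then have "(\<Sum>k=m..<n. (decay_scale k)\<^sup>2) = (\<Sum>k<n-m. (decay_scale (k + m))\<^sup>2)"
    by (intro sum.reindex_bij_witness[of _ "\<lambda>k. k + m" "\<lambda>k. k - m"]) auto
  also have "\<dots> \<le> (\<Sum>k. (decay_scale (k + m))\<^sup>2)"
    using summable_ignore_initial_segment[OF summable_decay_scale_sq, of m]
    by (intro sum_le_suminf) auto
  finally show ?thesis .
qed (use summable_ignore_initial_segment[OF summable_decay_scale_sq, of m] in \<open>simp add: suminf_nonneg\<close>)

text \<open>
  The \<open>j\<close>-th feedback term is switched on only once three bounds hold: the growing allowance \<open>H\<close>
  can pay for all the amplitudes up to \<open>c j\<close>, the scale \<open>decay_scale\<close> dominates the resulting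
  control, and the oscillatory error that the new term causes in each older orbit is at most
  \<open>(1/2) ^ j\<close>, so that infinitely many such errors remain summable.
\<close>
lemma switch_on_times_exist:
  fixes c H :: "nat \<Rightarrow> real" and D :: "nat \<Rightarrow> nat \<Rightarrow> real"
  assumes H: "filterlim H at_top sequentially"
  shows "\<exists>N. \<forall>j. j \<le> N j \<and>
     (\<forall>k\<ge>N j. (\<Sum>l\<le>j. c l) \<le> H k \<and> (\<Sum>l\<le>j. c l) \<le> real (Suc k) powr (1/4)) \<and>
     (\<forall>i\<le>j. D i j * scale_tail (N j) \<le> (1/2) ^ j)"
proof -
  have "\<exists>n. j \<le> n \<and>
     (\<forall>k\<ge>n. (\<Sum>l\<le>j. c l) \<le> H k \<and> (\<Sum>l\<le>j. c l) \<le> real (Suc k) powr (1/4)) \<and>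
     (\<forall>i\<le>j. D i j * scale_tail n \<le> (1/2) ^ j)" for j
  proof -
    have "real (Suc k) powr (1/4) = sqrt (sqrt (real (Suc k)))" for k
      by (simp add: powr_half_sqrt[symmetric] powr_powr)
    moreover have "filterlim (\<lambda>k. sqrt (sqrt (real (Suc k)))) at_top sequentially"
      by (intro filterlim_compose[OF sqrt_at_top]
            filterlim_compose[OF filterlim_real_sequentially filterlim_Suc])
    ultimately have "filterlim (\<lambda>k. real (Suc k) powr (1/4)) at_top sequentially"
      by simp
    then have "\<forall>\<^sub>F k in sequentially. (\<Sum>l\<le>j. c l) \<le> H k \<and> (\<Sum>l\<le>j. c l) \<le> real (Suc k) powr (1/4)"
      using H by (simp add: filterlim_at_top eventually_conj)
    then have 1: "\<forall>\<^sub>F n in sequentially. \<forall>k\<ge>n. (\<Sum>l\<le>j. c l) \<le> H k \<and> (\<Sum>l\<le>j. c l) \<le> real (Suc k) powr (1/4)"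
      by (rule eventually_all_ge_at_top)
    have 2: "\<forall>\<^sub>F n in sequentially. \<forall>i\<in>{..j}. D i j * scale_tail n \<le> (1/2) ^ j"
    proof (rule eventually_ball_finite)
      show "\<forall>i\<in>{..j}. \<forall>\<^sub>F n in sequentially. D i j * scale_tail n \<le> (1/2) ^ j"
      proof
        fix i
        have "(\<lambda>n. D i j * scale_tail n) \<longlonglongrightarrow> D i j * 0"
          by (intro tendsto_mult_left scale_tail_tendsto_0)
        then have "\<forall>\<^sub>F n in sequentially. D i j * scale_tail n < (1/2) ^ j"
          by (rule order_tendstoD) simp
        then show "\<forall>\<^sub>F n in sequentially. D i j * scale_tail n \<le> (1/2) ^ j"
          by (rule eventually_mono) simp
      qed
    qed simp
    show ?thesis
      using eventually_happens'[OF sequentially_bot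
          eventually_conj[OF eventually_conj[OF 1 2] eventually_ge_at_top[of j]]]
      by (auto simp only: atMost_iff)
  qed
  then show ?thesis by (intro choice allI)
qed

text \<open>
  Each active term pushes its own orbit towards the origin by reacting to its current phase. The
  cut-off \<open>j \<le> k\<close> makes the sum finite and excludes no active term when \<open>j \<le> N j\<close>.
\<close>
definition feedback :: "(nat \<Rightarrow> nat) \<Rightarrow> (nat \<Rightarrow> real) \<Rightarrow> nat \<Rightarrow> (nat \<Rightarrow> complex) \<Rightarrow> real" where
  "feedback N c k Z = (\<Sum>j\<le>k. if N j \<le> k then c j / real (Suc k) * Im ((sgn (Z j))\<^sup>2) else 0)"

primrec feedback_orbit ::
    "(nat \<Rightarrow> nat) \<Rightarrow> (nat \<Rightarrow> real) \<Rightarrow> (nat \<Rightarrow> real) \<Rightarrow> (nat \<Rightarrow> real) \<Rightarrow> (nat \<Rightarrow> complex) \<Rightarrow>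
     nat \<Rightarrow> nat \<Rightarrow> complex" where
  "feedback_orbit N c \<kappa> \<eta> z0 0 = z0"
| "feedback_orbit N c \<kappa> \<eta> z0 (Suc k) = (let Z = feedback_orbit N c \<kappa> \<eta> z0 k in
     (\<lambda>i. cis (\<eta> i) * (Z i - of_real (\<kappa> i * feedback N c k Z * Im (Z i)))))"

text \<open>
  The terms active at time \<open>k\<close> need not form an initial segment, but they lie below the largest
  active index \<open>J\<close>, and \<open>N J \<le> k\<close> already bounds the amplitudes of that whole segment.
\<close>
lemma feedback_bounds:
  fixes c H :: "nat \<Rightarrow> real"
  assumes c: "\<And>j. c j \<ge> 0" and H: "H k \<ge> 0"
    and N: "\<And>j. N j \<le> k \<Longrightarrow> (\<Sum>l\<le>j. c l) \<le> H k"
  shows "\<bar>feedback N c k Z\<bar> \<le> H k / real (Suc k)"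
proof -
  define A where "A = {j. j \<le> k \<and> N j \<le> k}"
  have fin: "finite A" by (simp add: A_def)
  have "sum c A \<le> H k"
  proof (cases "A = {}")
    case False
    then have M: "Max A \<in> A" by (rule Max_in[OF fin])
    have "sum c A \<le> (\<Sum>l\<le>Max A. c l)"
      using fin c by (intro sum_mono2) auto
    also have "\<dots> \<le> H k" using N M by (simp add: A_def)
    finally show ?thesis .
  qed (simp add: H)
  moreover have "\<bar>feedback N c k Z\<bar> \<le> (\<Sum>j\<in>A. c j / real (Suc k))"
  proof -
    have "norm (Im ((sgn z)\<^sup>2)) \<le> 1" for z :: complex
      using abs_Im_le_cmod[of "(sgn z)\<^sup>2"] by (auto simp: norm_power norm_sgn split: if_splits)
    then have "norm (c j / real (Suc k) * Im ((sgn z)\<^sup>2)) \<le> c j / real (Suc k)" for j z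
      using c[of j] by (simp only: norm_mult) (intro mult_left_le[THEN order_trans], auto)
    moreover have "feedback N c k Z = (\<Sum>j\<in>A. c j / real (Suc k) * Im ((sgn (Z j))\<^sup>2))"
      unfolding feedback_def A_def by (subst sum.inter_filter[symmetric]) auto
    ultimately show ?thesis by (simp only: real_norm_def[symmetric]) (intro sum_norm_le)
  qed
  moreover have "(\<Sum>j\<in>A. c j / real (Suc k)) = sum c A / real (Suc k)"
    by (simp add: sum_divide_distrib)
  ultimately show ?thesis
    using divide_right_mono[of "sum c A" "H k" "real (Suc k)"] by simp
qed

text \<open>
  One scalar control damps infinitely many rotating phases. By \<open>shear_step\<close> the loss of
  \<open>ln |z i|\<^sup>2\<close> is governed by \<open>\<Sum>k. t k * Im (W i k)\<close>, where \<open>W i\<close> is the squared phase. Inserting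
  the feedback for \<open>t\<close>, the own term of the orbit \<open>i\<close> contributes \<open>c i / 2\<close> times a harmonic sum and
  the other terms contribute a convergent series of oscillatory errors. The amplitude
  \<open>c i = 4 / \<kappa> i\<close> turns this into a loss of \<open>2 ln n\<close>.

  The orbits are quantified after the control, although the feedback is computed from them: the
  recursion determines an orbit from its initial value.
\<close>
lemma simultaneous_decay_control:
  fixes \<kappa> \<eta> H :: "nat \<Rightarrow> real" and z0 :: "nat \<Rightarrow> complex"
  assumes \<kappa>: "\<And>i. \<kappa> i > 0" and z0: "\<And>i. z0 i \<noteq> 0"
    and sum: "\<And>i j. cis (2 * \<eta> i + 2 * \<eta> j) \<noteq> 1"
    and diff: "\<And>i j. i \<noteq> j \<Longrightarrow> cis (2 * \<eta> i - 2 * \<eta> j) \<noteq> 1"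
    and H: "\<And>k. H k > 0" "filterlim H at_top sequentially"
  shows "\<exists>t. (\<forall>k. \<bar>t k\<bar> \<le> H k / real (Suc k)) \<and>
     (\<forall>i. \<exists>B. \<forall>z. z 0 = z0 i \<longrightarrow>
        (\<forall>k. z (Suc k) = cis (\<eta> i) * (z k - of_real (\<kappa> i * t k * Im (z k)))) \<longrightarrow>
        (\<forall>k. norm (z k) \<le> B / real (Suc k)))"
proof -
  define c where "c i = 4 / \<kappa> i" for i
  have c: "c i > 0" for i using \<kappa> by (simp add: c_def)
  \<comment> \<open>Naming the bound as a predicate makes the choice of the constants \<open>D i j\<close> first-order.\<close>
  define R where "R i j B \<longleftrightarrow> B \<ge> 0 \<and> (\<forall>t V W \<epsilon> m n.
     near_rotation (2 * \<eta> i) (4 * \<kappa> i) t V \<and> near_rotation (2 * \<eta> j) (4 * \<kappa> j) t W \<and>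
     (i = j \<longrightarrow> V = W) \<and> (\<forall>k. \<epsilon> k \<ge> 0 \<and> \<epsilon> (Suc k) \<le> \<epsilon> k) \<and> m \<le> n \<longrightarrow>
     \<bar>\<Sum>k=m..<n. \<epsilon> k * (Im (V k) * Im (W k) - (if i = j then 1/2 else 0))\<bar>
       \<le> B * (\<epsilon> m + (\<Sum>k=m..<n. \<epsilon> k * \<bar>t k\<bar>)))" for i j B
  have "\<exists>B. R i j B" for i j
    unfolding R_def using \<kappa>[of i] \<kappa>[of j] by (intro sine_correlation_bound sum diff) auto
  then obtain D where RD: "\<And>i j. R i j (D i j)" by metis
  have D0: "\<And>i j. D i j \<ge> 0" using RD by (simp add: R_def)
  have D: "\<bar>\<Sum>k=m..<n. \<epsilon> k * (Im (V k) * Im (W k) - (if i = j then 1/2 else 0))\<bar>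
       \<le> D i j * (\<epsilon> m + (\<Sum>k=m..<n. \<epsilon> k * \<bar>t k\<bar>))"
    if "near_rotation (2 * \<eta> i) (4 * \<kappa> i) t V" "near_rotation (2 * \<eta> j) (4 * \<kappa> j) t W"
     "i = j \<Longrightarrow> V = W" "\<And>k. \<epsilon> k \<ge> 0" "\<And>k. \<epsilon> (Suc k) \<le> \<epsilon> k" "m \<le> n" for i j t V W \<epsilon> m n
  proof -
    have "near_rotation (2 * \<eta> i) (4 * \<kappa> i) t V \<and> near_rotation (2 * \<eta> j) (4 * \<kappa> j) t W \<and>
     (i = j \<longrightarrow> V = W) \<and> (\<forall>k. \<epsilon> k \<ge> 0 \<and> \<epsilon> (Suc k) \<le> \<epsilon> k) \<and> m \<le> n"
      using that by simp
    then show ?thesis using RD[of i j] unfolding R_def by blast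
  qed
  obtain N where N: "\<And>j. j \<le> N j" "\<And>j k. N j \<le> k \<Longrightarrow> (\<Sum>l\<le>j. c l) \<le> H k"
    "\<And>j k. N j \<le> k \<Longrightarrow> (\<Sum>l\<le>j. c l) \<le> real (Suc k) powr (1/4)"
    "\<And>i j. i \<le> j \<Longrightarrow> D i j * scale_tail (N j) \<le> (1/2) ^ j"
    using switch_on_times_exist[OF H(2), of c D] by blast
  define Z where "Z = feedback_orbit N c \<kappa> \<eta> z0"
  define t where "t k = feedback N c k (Z k)" for k
  define W where "W i k = (sgn (Z k i))\<^sup>2" for i k
  have Z0: "Z 0 i = z0 i" and ZS: "Z (Suc k) i = cis (\<eta> i) * (Z k i - of_real (\<kappa> i * t k * Im (Z k i)))" for i k
    by (simp_all add: Z_def t_def Let_def)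
  have tH: "\<bar>t k\<bar> \<le> H k / real (Suc k)" for k
    unfolding t_def using c H(1)[of k] N(2) by (intro feedback_bounds) (auto simp: less_imp_le)
  have scale: "real (Suc k) powr (1/4) / real (Suc k) = decay_scale k" for k
    using powr_diff[of "real (Suc k)" "1/4" 1] by (simp add: decay_scale_def)
  have t: "\<bar>t k\<bar> \<le> decay_scale k" for k
    unfolding t_def scale[symmetric] using c N(3)
    by (intro feedback_bounds) (auto simp: less_imp_le)
  have Znz: "Z k i \<noteq> 0" for k i
    using z0[of i] shear_step(1)[OF _ ZS \<kappa>] by (induction k) (auto simp: Z0)
  have rot: "near_rotation (2 * \<eta> i) (4 * \<kappa> i) t (W i)" for i
    unfolding near_rotation_def W_def using shear_step(2)[OF Znz ZS \<kappa>] Znz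
    by (auto simp: norm_power norm_sgn)
  \<comment> \<open>\<open>e i j\<close> bounds the influence of the \<open>j\<close>-th feedback term on the orbit \<open>i\<close>, up to its mean.\<close>
  define e where "e i j = D i j * scale_tail (N j)" for i j
  have e0: "e i j \<ge> 0" for i j
    unfolding e_def scale_tail_def using D0[of i j]
    by (intro mult_nonneg_nonneg add_nonneg_nonneg suminf_nonneg
          summable_ignore_initial_segment summable_decay_scale_sq) (auto simp: decay_scale_def)
  have corr: "(\<Sum>k=N j..<n. c j / real (Suc k) * (Im (W i k) * Im (W j k)))
      \<ge> (if i = j then 1/2 * (\<Sum>k=N j..<n. c j / real (Suc k)) else 0) - e i j" for i j n
  proof (cases "N j \<le> n")
    case False
    then show ?thesis using e0[of i j] by (cases "i = j") simp_all
  next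
    case True
    define \<epsilon> where "\<epsilon> k = c j / real (Suc k)" for k
    have \<epsilon>0: "\<epsilon> k \<ge> 0" for k using c[of j] by (simp add: \<epsilon>_def)
    have \<epsilon>d: "\<epsilon> (Suc k) \<le> \<epsilon> k" for k using c[of j] by (simp add: \<epsilon>_def frac_le)
    have \<epsilon>s: "\<epsilon> k \<le> decay_scale k" if "N j \<le> k" for k
    proof -
      have "c j \<le> (\<Sum>l\<le>j. c l)" using c by (intro member_le_sum) (auto simp: less_imp_le)
      also have "\<dots> \<le> real (Suc k) powr (1/4)" using N(3) that by blast
      finally show ?thesis unfolding \<epsilon>_def scale[symmetric] by (intro divide_right_mono) auto
    qed
    have "(\<Sum>k=N j..<n. \<epsilon> k * \<bar>t k\<bar>) \<le> (\<Sum>k=N j..<n. (decay_scale k)\<^sup>2)"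
      unfolding power2_eq_square using \<epsilon>s t \<epsilon>0
      by (intro sum_mono mult_mono) (auto intro: order_trans[OF \<epsilon>0 \<epsilon>s])
    then have "\<epsilon> (N j) + (\<Sum>k=N j..<n. \<epsilon> k * \<bar>t k\<bar>) \<le> scale_tail (N j)"
      using \<epsilon>s[of "N j"] sum_decay_scale_sq_le[of "N j" n] unfolding scale_tail_def by linarith
    then have "D i j * (\<epsilon> (N j) + (\<Sum>k=N j..<n. \<epsilon> k * \<bar>t k\<bar>)) \<le> e i j"
      unfolding e_def by (intro mult_left_mono D0)
    moreover have "\<bar>\<Sum>k=N j..<n. \<epsilon> k * (Im (W i k) * Im (W j k) - (if i = j then 1/2 else 0))\<bar>
        \<le> D i j * (\<epsilon> (N j) + (\<Sum>k=N j..<n. \<epsilon> k * \<bar>t k\<bar>))"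
      using True by (intro D rot \<epsilon>0 \<epsilon>d) auto
    moreover have "(\<Sum>k=N j..<n. \<epsilon> k * (Im (W i k) * Im (W j k) - (if i = j then 1/2 else 0)))
        = (\<Sum>k=N j..<n. \<epsilon> k * (Im (W i k) * Im (W j k)))
          - (if i = j then 1/2 * (\<Sum>k=N j..<n. \<epsilon> k) else 0)"
      by (simp add: right_diff_distrib sum_subtractf sum_divide_distrib)
    ultimately show ?thesis unfolding \<epsilon>_def by linarith
  qed
  have esum: "summable (e i)" for i
  proof (rule summable_comparison_test'[where N = i])
    show "summable (\<lambda>j. (1/2::real) ^ j)" by (rule summable_geometric) simp
    show "norm (e i j) \<le> (1/2) ^ j" if "j \<ge> i" for j
      using N(4)[OF that] e0[of i j] by (simp add: e_def)
  qed
  have work: "(\<Sum>k<n. t k * Im (W i k)) \<ge> 1/2 * (\<Sum>k=N i..<n. c i / real (Suc k)) - suminf (e i)" for i n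
  proof -
    define g where "g j k = c j / real (Suc k) * (Im (W i k) * Im (W j k))" for j k
    \<comment> \<open>Up to time \<open>n\<close> only indices \<open>j < n\<close> can be active, because \<open>j \<le> N j\<close>.\<close>
    have "(\<Sum>k<n. t k * Im (W i k)) = (\<Sum>k<n. \<Sum>j<n. if N j \<le> k then g j k else 0)"
    proof (intro sum.cong refl)
      fix k assume k: "k \<in> {..<n}"
      have "t k * Im (W i k) = (\<Sum>j\<le>k. if N j \<le> k then g j k else 0)"
        unfolding t_def feedback_def sum_distrib_right g_def
        by (intro sum.cong) (auto simp: W_def)
      also have "\<dots> = (\<Sum>j<n. if N j \<le> k then g j k else 0)"
        using k N(1) by (intro sum.mono_neutral_left) (auto intro: order_trans)
      finally show "t k * Im (W i k) = (\<Sum>j<n. if N j \<le> k then g j k else 0)" .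
    qed
    also have "\<dots> = (\<Sum>j<n. \<Sum>k<n. if N j \<le> k then g j k else 0)" by (rule sum.swap)
    also have "\<dots> = (\<Sum>j<n. \<Sum>k=N j..<n. g j k)"
    proof (rule sum.cong[OF refl])
      fix j
      have "{k \<in> {..<n}. N j \<le> k} = {N j..<n}" by auto
      then show "(\<Sum>k<n. if N j \<le> k then g j k else 0) = (\<Sum>k=N j..<n. g j k)"
        by (simp add: sum.inter_filter[symmetric])
    qed
    also have "\<dots> \<ge> (\<Sum>j<n. (if i = j then 1/2 * (\<Sum>k=N j..<n. c j / real (Suc k)) else 0) - e i j)"
      unfolding g_def by (intro sum_mono corr)
    also have "(\<Sum>j<n. (if i = j then 1/2 * (\<Sum>k=N j..<n. c j / real (Suc k)) else 0) - e i j)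
        = 1/2 * (\<Sum>k=N i..<n. c i / real (Suc k)) - (\<Sum>j<n. e i j)"
    proof (cases "i < n")
      case True
      then show ?thesis by (simp add: sum_subtractf sum.delta)
    next
      case False
      then have "N i \<ge> n" using N(1)[of i] by simp
      then show ?thesis using False by (simp add: sum_subtractf sum.delta sum_negf)
    qed
    finally show ?thesis using sum_le_suminf[OF esum, of "{..<n}" i] e0 by fastforce
  qed
  have decay: "\<exists>B. \<forall>n. norm (Z n i) \<le> B / real (Suc n)" for i
  proof -
    define G where "G = ln ((norm (z0 i))\<^sup>2) + (\<kappa> i)\<^sup>2 * (\<Sum>k. (decay_scale k)\<^sup>2)
        + \<kappa> i * suminf (e i) + 2 * harm (N i)"
    have up: "ln ((norm (Z n i))\<^sup>2) \<le> ln ((norm (z0 i))\<^sup>2)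
        - \<kappa> i * (\<Sum>k<n. t k * Im (W i k)) + (\<kappa> i)\<^sup>2 * (\<Sum>k<n. (t k)\<^sup>2)" for n
    proof (induction n)
      case (Suc n)
      then show ?case
        using shear_step(3)[OF Znz[of n i] ZS \<kappa>] by (simp add: W_def algebra_simps)
    qed (simp add: Z0)
    have "norm (Z n i) \<le> exp (G / 2) / real (Suc n)" for n
    proof -
      have "(\<Sum>k<n. (t k)\<^sup>2) \<le> (\<Sum>k<n. (decay_scale k)\<^sup>2)"
        using power_mono[OF t abs_ge_zero, of _ 2] by (intro sum_mono) simp
      also have "\<dots> \<le> (\<Sum>k. (decay_scale k)\<^sup>2)"
        by (intro sum_le_suminf summable_decay_scale_sq) auto
      finally have s2: "(\<kappa> i)\<^sup>2 * (\<Sum>k<n. (t k)\<^sup>2) \<le> (\<kappa> i)\<^sup>2 * (\<Sum>k. (decay_scale k)\<^sup>2)"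
        by (intro mult_left_mono) auto
      have "harm n \<le> harm (N i) + (\<Sum>k=N i..<n. 1 / real (Suc k))"
      proof -
        have h: "harm m = (\<Sum>k<m. 1 / real (Suc k))" for m
          unfolding harm_def by (induction m) (auto simp: divide_inverse)
        show ?thesis
        proof (cases "N i \<le> n")
          case True
          then show ?thesis unfolding h
            by (metis (no_types) order_refl lessThan_atLeast0 le0 sum.atLeastLessThan_concat)
        next
          case False
          then show ?thesis unfolding h
            by (auto intro!: sum_mono2)
        qed
      qed
      moreover have "ln (real n + 1) \<le> harm n" by (rule ln_le_harm)
      ultimately have hb: "ln (real (Suc n)) \<le> harm (N i) + (\<Sum>k=N i..<n. 1 / real (Suc k))"
        by (simp add: add.commute)
      have "\<kappa> i * (1/2 * (\<Sum>k=N i..<n. c i / real (Suc k)) - suminf (e i)) \<le> \<kappa> i * (\<Sum>k<n. t k * Im (W i k))"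
        using \<kappa>[of i] work[where i=i and n=n] by (intro mult_left_mono) auto
      moreover have "\<kappa> i * (1/2 * (\<Sum>k=N i..<n. c i / real (Suc k)))
          = 2 * (\<Sum>k=N i..<n. 1 / real (Suc k))"
        unfolding sum_distrib_left using \<kappa>[of i] by (intro sum.cong) (simp_all add: c_def)
      ultimately have "ln ((norm (Z n i))\<^sup>2) \<le> G - 2 * ln (real (Suc n))"
        using up[of n] s2 hb unfolding G_def by (simp add: right_diff_distrib)
      then have "ln (norm (Z n i)) \<le> G / 2 - ln (real (Suc n))"
        using Znz[of n i] by (simp add: ln_realpow)
      then have "norm (Z n i) \<le> exp (G / 2 - ln (real (Suc n)))"
        using Znz[of n i] by (metis exp_le_cancel_iff exp_ln zero_less_norm_iff)
      then show ?thesis by (simp add: exp_diff)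
    qed
    then show ?thesis by blast
  qed
  have uniq: "z k = Z k i"
    if "z 0 = z0 i" "\<And>k. z (Suc k) = cis (\<eta> i) * (z k - of_real (\<kappa> i * t k * Im (z k)))" for z i k
    using that by (induction k) (simp_all add: Z0 ZS)
  show ?thesis
  proof (intro exI[of _ t] conjI allI)
    fix k
    show "\<bar>t k\<bar> \<le> H k / real (Suc k)" by (rule tH)
  next
    fix i
    obtain B where B: "\<And>n. norm (Z n i) \<le> B / real (Suc n)" using decay by blast
    show "\<exists>B. \<forall>z. z 0 = z0 i \<longrightarrow>
        (\<forall>k. z (Suc k) = cis (\<eta> i) * (z k - of_real (\<kappa> i * t k * Im (z k)))) \<longrightarrow>
        (\<forall>k. norm (z k) \<le> B / real (Suc k))"
    proof (intro exI[of _ B] allI impI)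
      fix z k
      assume "z 0 = z0 i" "\<forall>k. z (Suc k) = cis (\<eta> i) * (z k - of_real (\<kappa> i * t k * Im (z k)))"
      then have "z k = Z k i" by (intro uniq) auto
      then show "norm (z k) \<le> B / real (Suc k)" using B by simp
    qed
  qed
qed

section \<open>Elliptic coordinates\<close>

lemma trace_monodromy:
  assumes "jacobi_parameters T a b" "x \<in> sigma_ell T a b"
  defines "\<theta> \<equiv> quasi_momentum T a b x"
  shows "0 < \<theta>" "\<theta> < pi" "trace (monodromy T a b x) = 2 * cos \<theta>"
proof -
  have th: "0 < \<theta> \<and> \<theta> < pi \<and> complex_eigenvalues (monodromy T a b x) = {cis \<theta>, cis (- \<theta>)}"
    unfolding \<theta>_def quasi_momentum_def by (rule theI') (rule quasi_momentum_unique[OF assms(1,2)])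
  then show 1: "0 < \<theta>" "\<theta> < pi" by auto
  have "(cis \<theta>)\<^sup>2 - of_real (trace (monodromy T a b x)) * cis \<theta> + 1 = 0"
    using th complex_eigenvalues_2[of "monodromy T a b x"] det_monodromy[OF assms(1)] by auto
  then have "Im ((cis \<theta>)\<^sup>2 - of_real (trace (monodromy T a b x)) * cis \<theta> + 1) = 0" by simp
  then have "sin \<theta> * (2 * cos \<theta> - trace (monodromy T a b x)) = 0"
    by (simp add: power2_eq_square algebra_simps)
  then show "trace (monodromy T a b x) = 2 * cos \<theta>"
    using sin_gt_zero[OF 1] by simp
qed

text \<open>
  The number \<open>w\<close> comes from the left eigenvector \<open>(w, 1)\<close> of \<open>M\<close> for one of the eigenvalues
  \<open>cis (\<plusminus>\<theta>)\<close>, so \<open>w * y$1 + y$2\<close> is a complex coordinate on the plane in which \<open>M\<close> is a rotation.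
  Adding a multiple of \<open>y$1\<close> to \<open>y$2\<close> is then a shear along the real axis, since \<open>y$1\<close> is
  proportional to the imaginary part of the coordinate. The choice between the two eigenvalues is
  used to make the factor \<open>\<kappa>\<close> positive.
\<close>
lemma elliptic_coordinate:
  fixes M :: "real^2^2"
  assumes det: "det M = 1" and tr: "trace M = 2 * cos \<theta>" and \<theta>: "0 < \<theta>" "\<theta> < pi" and \<alpha>: "\<alpha> > 0"
  shows "\<exists>w \<kappa> \<eta>. Im w \<noteq> 0 \<and> \<kappa> > 0 \<and> (\<eta> = \<theta> \<or> \<eta> = - \<theta>) \<and>
     (\<forall>y. w * (M *v y)$1 + (M *v y)$2 = cis \<eta> * (w * y$1 + y$2)) \<and>
     (\<forall>y1. \<kappa> * (Im w * y1) = y1 / \<alpha>)"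
proof -
  define m11 where "m11 = M$1$1"
  define m12 where "m12 = M$1$2"
  define m21 where "m21 = M$2$1"
  define m22 where "m22 = M$2$2"
  have d: "m11 * m22 - m12 * m21 = 1" and t: "m11 + m22 = 2 * cos \<theta>"
    using det tr by (simp_all add: m11_def m12_def m21_def m22_def det_2 trace_def sum_2)
  have s: "sin \<theta> > 0" using \<theta> by (rule sin_gt_zero)
  have m12: "m12 \<noteq> 0"
  proof
    assume "m12 = 0"
    then have "(m11 - m22)\<^sup>2 = (m11 + m22)\<^sup>2 - 4" using d by (simp add: power2_eq_square algebra_simps)
    also have "\<dots> = - 4 * (sin \<theta>)\<^sup>2" by (simp add: t sin_squared_eq power_mult_distrib)
    finally show False using s by (smt (verit) zero_le_power2 zero_less_power2)
  qed
  \<comment> \<open>\<open>Im w = sin \<eta> / m12\<close> has to be positive.\<close>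
  define \<eta> where "\<eta> = (if m12 > 0 then \<theta> else - \<theta>)"
  have t': "m11 + m22 = 2 * cos \<eta>" using t by (simp add: \<eta>_def)
  have pos: "sin \<eta> / m12 > 0" using s m12 by (auto simp: \<eta>_def divide_pos_neg)
  define w where "w = (cis \<eta> - of_real m22) / of_real m12"
  have Im_w: "Im w = sin \<eta> / m12" by (simp add: w_def Im_divide_of_real)
  have e1: "w * m12 + m22 = cis \<eta>" using m12 by (simp add: w_def)
  have char: "cis \<eta> * (cis \<eta> - m22) = m11 * (cis \<eta> - m22) + m21 * m12"
  proof -
    have sc: "cos \<eta> * cos \<eta> + sin \<eta> * sin \<eta> = 1" by (rule sin_cos_squared_add3)
    have m22: "m22 = 2 * cos \<eta> - m11" using t' by simp
    have "m21 * m12 = m11 * m22 - 1" using d by (simp add: algebra_simps)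
    then have "m21 * m12 = m11 * (2 * cos \<eta> - m11) - 1" using m22 by simp
    moreover have "sin \<eta> * sin \<eta> = 1 - cos \<eta> * cos \<eta>" using sc by linarith
    ultimately show ?thesis
      by (simp add: complex_eq_iff m22 algebra_simps del: of_real_mult flip: of_real_mult)
  qed
  have e2: "w * m11 + m21 = cis \<eta> * w"
    using m12 char by (simp add: w_def field_simps)
  have "w * (M *v y)$1 + (M *v y)$2 = cis \<eta> * (w * y$1 + y$2)" for y
  proof -
    have "w * (M *v y)$1 + (M *v y)$2 = (w * m11 + m21) * y$1 + (w * m12 + m22) * y$2"
      by (simp add: matrix_vector_mult_def sum_2 m11_def m12_def m21_def m22_def algebra_simps)
    then show ?thesis unfolding e1 e2 by (simp add: algebra_simps)
  qed
  moreover have "1 / (\<alpha> * Im w) * (Im w * y1) = y1 / \<alpha>" for y1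
    using pos \<alpha> unfolding Im_w[symmetric] by simp
  moreover have "1 / (\<alpha> * Im w) > 0" "Im w \<noteq> 0" using pos \<alpha> unfolding Im_w[symmetric] by simp_all
  moreover have "\<eta> = \<theta> \<or> \<eta> = - \<theta>" by (auto simp: \<eta>_def)
  ultimately show ?thesis by blast
qed

section \<open>Solutions over whole periods\<close>

text \<open>
  The value \<open>0\<close> at the index \<open>0\<close> turns the boundary row of the operator into an instance of the
  three-term recursion, whatever coefficient multiplies it; \<open>a T\<close> is the one for which the first
  step is given by the first transfer matrix.
\<close>
fun jacobi_solution :: "nat \<Rightarrow> (nat \<Rightarrow> real) \<Rightarrow> (nat \<Rightarrow> real) \<Rightarrow> (nat \<Rightarrow> real) \<Rightarrow> real \<Rightarrow> nat \<Rightarrow> real"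
  where
  "jacobi_solution T a b Q x 0 = 0"
| "jacobi_solution T a b Q x (Suc 0) = 1"
| "jacobi_solution T a b Q x (Suc (Suc n)) =
     ((x - b (Suc n) - Q (Suc n)) * jacobi_solution T a b Q x (Suc n)
       - (if n = 0 then a T else a n) * jacobi_solution T a b Q x n) / a (Suc n)"

definition solution_vector ::
    "nat \<Rightarrow> (nat \<Rightarrow> real) \<Rightarrow> (nat \<Rightarrow> real) \<Rightarrow> (nat \<Rightarrow> real) \<Rightarrow> real \<Rightarrow> nat \<Rightarrow> real^2" where
  "solution_vector T a b Q x n =
     vector [jacobi_solution T a b Q x n, jacobi_solution T a b Q x (Suc n)]"

lemma jacobi_solution_eigen_equation:
  assumes "jacobi_parameters T a b" "n \<ge> 1"
  shows "jacobi_op a b (jacobi_solution T a b Q x) n + diag_op Q (jacobi_solution T a b Q x) n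
           = x * jacobi_solution T a b Q x n"
proof -
  obtain m where n: "n = Suc m" using assms(2) by (cases n) auto
  have "a (Suc m) > 0" using assms by (simp add: jacobi_parameters_def n)
  then have a: "a (Suc m) \<noteq> 0" by simp
  have "a (Suc m) * jacobi_solution T a b Q x (Suc (Suc m))
      = (x - b (Suc m) - Q (Suc m)) * jacobi_solution T a b Q x (Suc m)
        - (if m = 0 then a T else a m) * jacobi_solution T a b Q x m"
    using a by simp
  then show ?thesis
    by (cases "m = 0") (auto simp del: jacobi_solution.simps(3)
        simp: n jacobi_op_def diag_op_def numeral_2_eq_2 algebra_simps)
qed

lemma periodic_shift:
  assumes "jacobi_parameters T a b" "n \<ge> 1"
  shows "a (k * T + n) = a n" "b (k * T + n) = b n"
proof -
  have "a (k * T + n) = a n \<and> b (k * T + n) = b n"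
  proof (induction k)
    case (Suc k)
    have "k * T + n \<ge> 1" using assms by simp
    then have "a (k * T + n + T) = a (k * T + n)" "b (k * T + n + T) = b (k * T + n)"
      using assms by (auto simp: jacobi_parameters_def)
    moreover have "k * T + n + T = Suc k * T + n" by simp
    ultimately show ?case using Suc by metis
  qed simp
  then show "a (k * T + n) = a n" "b (k * T + n) = b n" by auto
qed

lemma solution_vector_step:
  assumes J: "jacobi_parameters T a b"
  shows "solution_vector T a b Q x (Suc (k * T + r)) =
     transfer_matrix T a b x (Suc r) *v solution_vector T a b Q x (k * T + r)
     - vector [0, Q (Suc (k * T + r)) / a (Suc r) * jacobi_solution T a b Q x (Suc (k * T + r))]"
proof -
  have a: "a (Suc (k * T + r)) = a (Suc r)" "b (Suc (k * T + r)) = b (Suc r)"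
    using periodic_shift[OF J, of "Suc r" k] by auto
  have a0: "(if k * T + r = 0 then a T else a (k * T + r)) = (if r = 0 then a T else a r)"
  proof (cases "r = 0 \<and> k > 0")
    case True
    then obtain l where l: "k = Suc l" by (cases k) auto
    have "T \<ge> 1" using J by (simp add: jacobi_parameters_def)
    then show ?thesis using True periodic_shift(1)[OF J, of T l] by (simp add: l add.commute)
  next
    case False
    then show ?thesis using periodic_shift(1)[OF J, of r k] J
      by (cases "r = 0") (auto simp: jacobi_parameters_def)
  qed
  define n where "n = k * T + r"
  have "jacobi_solution T a b Q x (Suc (Suc n)) =
      ((x - b (Suc r) - Q (Suc n)) * jacobi_solution T a b Q x (Suc n)
        - (if r = 0 then a T else a r) * jacobi_solution T a b Q x n) / a (Suc r)"
    using a a0 by (simp only: n_def[symmetric] jacobi_solution.simps(3))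
  then show ?thesis
    unfolding n_def[symmetric] solution_vector_def
    by (simp add: vec_eq_iff forall_2 transfer_matrix_def matrix_vector_mult_def sum_2
        diff_divide_distrib left_diff_distrib del: jacobi_solution.simps(3))
qed

lemma solution_vector_within_period:
  assumes J: "jacobi_parameters T a b"
    and Q: "\<And>n. \<not> T dvd n \<Longrightarrow> Q n = 0" and r: "r < T"
  shows "solution_vector T a b Q x (k * T + r) =
     transfer_product T a b x r *v solution_vector T a b Q x (k * T)"
  using r
proof (induction r)
  case (Suc r)
  have "\<not> T dvd Suc (k * T + r)"
    using Suc.prems by (metis add_Suc_right dvd_add_right_iff dvd_imp_le dvd_triv_right not_less zero_less_Suc)
  then have "solution_vector T a b Q x (Suc (k * T + r)) =
     transfer_matrix T a b x (Suc r) *v solution_vector T a b Q x (k * T + r)"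
    using solution_vector_step[OF J, of Q x k r] Q
    by (simp add: vec_eq_iff forall_2)
  then show ?case using Suc by (simp add: matrix_vector_mul_assoc)
qed simp

text \<open>
  With a potential that lives on the multiples of the period, a whole period acts as the monodromy
  matrix followed by a single shear.
\<close>
lemma solution_vector_period:
  assumes J: "jacobi_parameters T a b"
    and Q: "\<And>n. \<not> T dvd n \<Longrightarrow> Q n = 0"
    and v: "\<And>k. v k = solution_vector T a b Q x (k * T)"
  shows "v (Suc k) = monodromy T a b x *v v k
     - vector [0, Q (Suc k * T) / a T * (monodromy T a b x *v v k)$1]"
proof -
  obtain r where T: "T = Suc r" using J by (cases T) (auto simp: jacobi_parameters_def)
  have n: "Suc (k * T + r) = Suc k * T" by (simp add: T)
  have eq: "v (Suc k) = monodromy T a b x *v v k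
      - vector [0, Q (Suc k * T) / a T * jacobi_solution T a b Q x (Suc k * T)]"
    using solution_vector_step[OF J, of Q x k r]
      solution_vector_within_period[OF J, of Q r x k, OF Q]
    unfolding n v monodromy_def by (simp add: T matrix_vector_mul_assoc)
  moreover have "jacobi_solution T a b Q x (Suc k * T) = (v (Suc k))$1"
    by (simp add: v solution_vector_def)
  moreover have "(v (Suc k))$1 = (monodromy T a b x *v v k)$1"
    by (subst eq) simp
  ultimately show ?thesis by simp
qed

lemma l2_seq_of_inverse_decay:
  assumes "\<And>n. \<bar>u n\<bar> \<le> B / real (Suc n)"
  shows "u \<in> l2_seq"
proof -
  have "summable (\<lambda>n. inverse (real (Suc n) ^ 2))"
    by (subst summable_Suc_iff, rule inverse_power_summable) simp
  then have "summable (\<lambda>n. B\<^sup>2 * inverse (real (Suc n) ^ 2))" by (rule summable_mult)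
  moreover have "norm ((u n)\<^sup>2) \<le> B\<^sup>2 * inverse (real (Suc n) ^ 2)" for n
    using power_mono[OF assms[of n], of 2] by (simp add: power_divide divide_inverse power_mult_distrib power_inverse)
  ultimately have "summable (\<lambda>n. (u n)\<^sup>2)" by (rule summable_comparison_test'[where N = 0])
  then have "(\<lambda>n. (u n)\<^sup>2) summable_on UNIV"
    by (subst summable_on_UNIV_nonneg_real_iff) auto
  then show ?thesis unfolding l2_seq_def
    using summable_on_subset_banach[OF _ subset_UNIV] by blast
qed

text \<open>
  Inside a period a solution arises from its vector at the start of the period by one of only
  \<open>T\<close> matrices.
\<close>
lemma decay_between_periods:
  assumes J: "jacobi_parameters T a b"
    and Q: "\<And>n. \<not> T dvd n \<Longrightarrow> Q n = 0"
    and bound: "\<And>k. norm (solution_vector T a b Q x (k * T)) \<le> B / real (Suc k)"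
  shows "\<exists>B'. \<forall>n. \<bar>jacobi_solution T a b Q x n\<bar> \<le> B' / real (Suc n)"
proof (intro exI allI)
  fix n
  define C where "C = (\<Sum>r<T. onorm ((*v) (transfer_product T a b x r)))"
  define k r where "k = n div T" and "r = n mod T"
  have T: "T \<ge> 1" using J by (simp add: jacobi_parameters_def)
  have n: "n = k * T + r" and r: "r < T" using T by (simp_all add: k_def r_def)
  have B: "B \<ge> 0" using order_trans[OF norm_ge_zero bound[of 0]] by simp
  have on: "onorm ((*v) (transfer_product T a b x s)) \<ge> 0" for s
    by (intro onorm_pos_le matrix_vector_mul_bounded_linear)
  have C: "onorm ((*v) (transfer_product T a b x r)) \<le> C"
    unfolding C_def using r on by (intro member_le_sum) auto
  have "\<bar>jacobi_solution T a b Q x n\<bar> \<le> norm (solution_vector T a b Q x n)"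
    using component_le_norm_cart[of "solution_vector T a b Q x n" 1] by (simp add: solution_vector_def)
  also have "\<dots> = norm (transfer_product T a b x r *v solution_vector T a b Q x (k * T))"
    using solution_vector_within_period[OF J, of Q r x k, OF Q r] n by simp
  also have "\<dots> \<le> onorm ((*v) (transfer_product T a b x r)) * norm (solution_vector T a b Q x (k * T))"
    by (intro onorm matrix_vector_mul_bounded_linear)
  also have "\<dots> \<le> C * (B / real (Suc k))"
    using C bound[of k] on order_trans[OF on C] by (intro mult_mono) auto
  also have "\<dots> \<le> C * B * T / real (Suc n)"
  proof -
    have "Suc n \<le> T * Suc k" using n r by (simp add: algebra_simps)
    then have "real (Suc n) \<le> real T * real (Suc k)" by (metis of_nat_mono of_nat_mult)
    then have "(C * B) * real (Suc n) \<le> (C * B) * (real T * real (Suc k))"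
      using B order_trans[OF on C] by (intro mult_left_mono) auto
    then show ?thesis by (simp add: field_simps)
  qed
  finally show "\<bar>jacobi_solution T a b Q x n\<bar> \<le> C * B * T / real (Suc n)"
    unfolding C_def .
qed

section \<open>Absence of resonances\<close>

lemma rationally_independentD:
  assumes ri: "rationally_independent xs" and A: "A \<subseteq> set xs"
    and rel: "(\<Sum>v\<in>A. of_rat (u v) * v) = 0" and v: "v \<in> A"
  shows "u v = 0"
proof -
  have m: "module (\<lambda>(r::rat) (x::real). of_rat r * x)"
    by unfold_locales (simp_all add: algebra_simps of_rat_add of_rat_mult)
  have "module.independent (\<lambda>(r::rat) (x::real). of_rat r * x) (set xs)"
    using ri by (simp add: rationally_independent_def)
  then show ?thesis
    by (rule module.independentD[OF m _ finite_subset[OF A] A rel v]) simp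
qed

lemma cis_eq_1_iff_int: "cis (2 * x) = 1 \<longleftrightarrow> (\<exists>k::int. x = of_int k * pi)"
proof -
  have "cis (2 * x) = 1 \<longleftrightarrow> cos (2 * x) = 1"
    by (auto simp: complex_eq_iff dest: cos_one_sin_zero)
  also have "\<dots> \<longleftrightarrow> (\<exists>k::int. x = of_int k * pi)"
    by (auto simp: cos_one_2pi_int)
  finally show ?thesis .
qed

text \<open>
  A trivial rotation would be a rational relation between \<open>pi\<close> and at most two of the numbers \<open>\<theta> i\<close>.
  As \<open>\<theta> 0\<close> is itself a rational multiple of \<open>pi\<close>, every such relation involving an index other
  than \<open>0\<close> contradicts independence, and \<open>2 * \<theta> 0\<close> is a multiple of \<open>pi\<close> only at \<open>pi / 2\<close>.
\<close>
lemma no_resonance: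
  fixes \<theta> \<eta> :: "nat \<Rightarrow> real" and r :: rat
  assumes \<theta>: "\<And>i. 0 < \<theta> i" "\<And>i. \<theta> i < pi"
    and indep: "\<And>n. n \<ge> 1 \<Longrightarrow> rationally_independent (pi # map \<theta> [1..<Suc n])"
    and \<theta>0: "\<theta> 0 = of_rat r * pi" and \<theta>0': "\<theta> 0 \<noteq> pi / 2"
    and \<eta>: "\<And>i. \<eta> i = \<theta> i \<or> \<eta> i = - \<theta> i"
  shows "cis (2 * \<eta> i + 2 * \<eta> j) \<noteq> 1" and "i \<noteq> j \<Longrightarrow> cis (2 * \<eta> i - 2 * \<eta> j) \<noteq> 1"
proof -
  have irrational: "\<theta> i \<noteq> of_rat s * pi" if i: "0 < i" for i s
  proof
    assume eq: "\<theta> i = of_rat s * pi"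
    define u where "u v = (if v = pi then s else - 1)" for v
    have "rationally_independent (pi # map \<theta> [1..<Suc i])"
      using i by (intro indep) simp
    moreover have "{pi, \<theta> i} \<subseteq> set (pi # map \<theta> [1..<Suc i])"
      using i by auto
    moreover have "(\<Sum>v\<in>{pi, \<theta> i}. of_rat (u v) * v) = 0"
      using \<theta>(2)[of i] eq by (simp add: u_def of_rat_minus)
    ultimately have "u (\<theta> i) = 0" by (rule rationally_independentD) simp
    then show False using \<theta>(2)[of i] by (simp add: u_def)
  qed
  have unrelated: "\<theta> i + of_rat s * \<theta> j \<noteq> of_rat l * pi" if "0 < i" "0 < j" "i \<noteq> j" for i j l s
  proof
    assume eq: "\<theta> i + of_rat s * \<theta> j = of_rat l * pi"
    define n where "n = max i j"
    define u where "u v = (if v = pi then - l else if v = \<theta> i then 1 else s)" for v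
    have ri: "rationally_independent (pi # map \<theta> [1..<Suc n])"
      using that by (intro indep) (simp add: n_def)
    then have "inj_on \<theta> {1..<Suc n}"
      by (simp add: rationally_independent_def distinct_map del: upt_Suc)
    then have distinct: "\<theta> i \<noteq> \<theta> j"
      using that by (auto simp: n_def dest: inj_onD)
    have "{pi, \<theta> i, \<theta> j} \<subseteq> set (pi # map \<theta> [1..<Suc n])"
      using that by (auto simp: n_def simp del: upt_Suc)
    moreover have "(\<Sum>v\<in>{pi, \<theta> i, \<theta> j}. of_rat (u v) * v) = 0"
      using \<theta>(2)[of i] \<theta>(2)[of j] distinct eq by (auto simp: u_def of_rat_minus)
    ultimately have "u (\<theta> i) = 0" by (rule rationally_independentD[OF ri]) simp
    then show False using \<theta>(2)[of i] by (simp add: u_def)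
  qed
  have resonance: "cis (2 * (\<theta> i + of_int s * \<theta> j)) \<noteq> 1"
    if s: "s = 1 \<or> s = -1 \<and> i \<noteq> j" for i j and s :: int
  proof
    assume "cis (2 * (\<theta> i + of_int s * \<theta> j)) = 1"
    then obtain k :: int where k: "\<theta> i + of_int s * \<theta> j = of_int k * pi"
      unfolding cis_eq_1_iff_int by blast
    show False
    proof (cases "i = j")
      case True
      with s k have k2: "2 * \<theta> i = of_int k * pi" by simp
      show False
      proof (cases "i = 0")
        case True
        have "0 < of_int k * pi" "of_int k * pi < 2 * pi" using k2 \<theta>(1,2)[of i] by linarith+
        then have "k = 1" by (simp add: zero_less_mult_iff)
        then show False using k2 \<theta>0' True by simp
      next
        case False
        then show False using irrational[of i "of_int k / 2"] k2 by (simp add: of_rat_divide)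
      qed
    next
      case False
      consider "i = 0" | "j = 0" | "0 < i" "0 < j" by auto
      then show False
      proof cases
        case 1
        then have "\<theta> j = of_rat (of_int s * (of_int k - r)) * pi"
          using k \<theta>0 s by (auto simp: of_rat_diff of_rat_mult of_rat_minus algebra_simps)
        then show False using irrational[of j] 1 False by auto
      next
        case 2
        then have "\<theta> i = of_rat (of_int k - of_int s * r) * pi"
          using k \<theta>0 by (simp add: of_rat_diff of_rat_mult algebra_simps)
        then show False using irrational[of i] 2 False by auto
      next
        case 3
        then show False using unrelated[of i j "of_int s" "of_int k"] k False by simp
      qed
    qed
  qed
  \<comment> \<open>Reversing the direction of both rotations, if necessary, makes the sign of \<open>\<theta> i\<close> positive.\<close>
  have resonance_signed: "cis (2 * (\<sigma> * \<theta> i + \<tau> * \<theta> j)) \<noteq> 1"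
    if \<sigma>: "\<sigma> = 1 \<or> \<sigma> = - 1" and \<tau>: "\<tau> = 1 \<or> \<tau> = - 1" and same: "i = j \<Longrightarrow> \<sigma> = \<tau>"
    for i j and \<sigma> \<tau> :: real
  proof
    assume 1: "cis (2 * (\<sigma> * \<theta> i + \<tau> * \<theta> j)) = 1"
    have st: "\<sigma> * \<sigma> = 1" "\<sigma> * \<tau> = 1 \<or> \<sigma> * \<tau> = - 1 \<and> i \<noteq> j" using that by auto
    have inv: "cis (- x) = 1" if "cis x = 1" for x using that by (simp add: complex_eq_iff)
    have "\<sigma> * (2 * (\<sigma> * \<theta> i + \<tau> * \<theta> j)) = 2 * ((\<sigma> * \<sigma>) * \<theta> i + (\<sigma> * \<tau>) * \<theta> j)"
      by (simp add: algebra_simps)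
    moreover have "cis (\<sigma> * (2 * (\<sigma> * \<theta> i + \<tau> * \<theta> j))) = 1"
      using \<sigma> 1 inv[OF 1] by (elim disjE) (simp_all only: mult_1 mult_minus1)
    ultimately have "cis (2 * (\<theta> i + (\<sigma> * \<tau>) * \<theta> j)) = 1" by (simp only: st(1) mult_1)
    then show False
      using st(2) resonance[of 1 i j] resonance[of "-1" i j] by auto
  qed
  define \<sigma> where "\<sigma> i = \<eta> i / \<theta> i" for i
  have \<sigma>: "\<sigma> i = 1 \<or> \<sigma> i = - 1" and \<eta>_\<sigma>: "\<eta> i = \<sigma> i * \<theta> i" for i
    using \<eta>[of i] \<theta>(1)[of i] by (auto simp: \<sigma>_def)
  show "cis (2 * \<eta> i + 2 * \<eta> j) \<noteq> 1" for i j
    using resonance_signed[OF \<sigma>[of i] \<sigma>[of j]] by (auto simp: \<eta>_\<sigma> distrib_left)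
  show "cis (2 * \<eta> i - 2 * \<eta> j) \<noteq> 1" if "i \<noteq> j" for i j
  proof -
    have "- \<sigma> j = 1 \<or> - \<sigma> j = - 1" using \<sigma>[of j] by auto
    from resonance_signed[OF \<sigma>[of i] this, of i j] that show ?thesis
      by (simp add: \<eta>_\<sigma> right_diff_distrib)
  qed
qed

section \<open>The embedded eigenvalues\<close>

lemma norm_le_coordinate:
  fixes v :: "real^2" and w :: complex
  assumes w: "Im w \<noteq> 0"
  shows "norm v \<le> (1 + (1 + norm w) / \<bar>Im w\<bar>) * norm (w * v$1 + v$2)"
proof -
  define n where "n = norm (w * v$1 + v$2)"
  have "\<bar>Im w\<bar> * \<bar>v$1\<bar> \<le> n"
    unfolding n_def using abs_Im_le_cmod[of "w * v$1 + v$2"] by (simp add: abs_mult)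
  then have 1: "\<bar>v$1\<bar> \<le> n / \<bar>Im w\<bar>" using w by (simp add: field_simps)
  have "\<bar>v$2\<bar> \<le> n + norm w * \<bar>v$1\<bar>"
    unfolding n_def using norm_triangle_ineq4[of "w * v$1 + v$2" "w * v$1"] by (simp add: norm_mult)
  also have "\<dots> \<le> n + norm w * (n / \<bar>Im w\<bar>)"
    by (intro add_left_mono mult_left_mono 1) simp
  finally have "\<bar>v$1\<bar> + \<bar>v$2\<bar> \<le> (1 + (1 + norm w) / \<bar>Im w\<bar>) * n"
    using 1 by (simp add: distrib_right add_divide_distrib)
  then show ?thesis
    using norm_le_l1_cart[of v] by (simp add: sum_2 n_def)
qed

theorem theorem4p2:
  fixes T :: nat and a b lam K :: "nat \<Rightarrow> real" and p q :: nat
  assumes "jacobi_parameters T a b"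
    and "\<And>i. i \<ge> 1 \<Longrightarrow> lam i \<in> sigma_ell T a b"
    and "\<And>n. n \<ge> 2 \<Longrightarrow>
           rationally_independent (pi # map (\<lambda>i. quasi_momentum T a b (lam i)) [2..<Suc n])"
    and "p \<ge> 1" and "q \<ge> 1" and "gcd p q = 1"
    and "quasi_momentum T a b (lam 1) = real p * pi / real q"
    and "quasi_momentum T a b (lam 1) \<noteq> pi / 2"
    and "\<And>n. n \<ge> 1 \<Longrightarrow> K n > 0"
    and "filterlim K at_top sequentially"
  shows "\<exists>Q :: nat \<Rightarrow> real.
           (\<forall>n\<ge>1. \<bar>Q n\<bar> \<le> K n / real n) \<and>
           (\<forall>i\<ge>1. \<exists>u \<in> l2_seq. (\<exists>n\<ge>1. u n \<noteq> 0) \<and>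
              (\<forall>n\<ge>1. jacobi_op a b u n + diag_op Q u n = lam i * u n))"
proof -
  note J = assms(1)
  define \<theta> where "\<theta> i = quasi_momentum T a b (lam (Suc i))" for i
  define M where "M i = monodromy T a b (lam (Suc i))" for i
  have ell: "lam (Suc i) \<in> sigma_ell T a b" for i using assms(2) by simp
  have T: "T \<ge> 1" "a T > 0" using J by (auto simp: jacobi_parameters_def)
  have \<theta>: "0 < \<theta> i" "\<theta> i < pi" "trace (M i) = 2 * cos (\<theta> i)" "det (M i) = 1" for i
    using trace_monodromy[OF J ell] det_monodromy[OF J] by (simp_all add: \<theta>_def M_def)
  define coordinate where "coordinate i w \<kappa> \<eta> \<longleftrightarrow> Im w \<noteq> 0 \<and> \<kappa> > 0 \<and> (\<eta> = \<theta> i \<or> \<eta> = - \<theta> i) \<and>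
     (\<forall>y. w * (M i *v y)$1 + (M i *v y)$2 = cis \<eta> * (w * y$1 + y$2)) \<and>
     (\<forall>y1. \<kappa> * (Im w * y1) = y1 / a T)" for i w \<kappa> \<eta>
  have "\<exists>w \<kappa> \<eta>. coordinate i w \<kappa> \<eta>" for i
    unfolding coordinate_def by (rule elliptic_coordinate[OF \<theta>(4) \<theta>(3) \<theta>(1) \<theta>(2) T(2)])
  then obtain w \<kappa> \<eta> where coord: "\<And>i. coordinate i (w i) (\<kappa> i) (\<eta> i)" by metis
  have Im_w: "Im (w i) \<noteq> 0" and \<kappa>: "\<kappa> i > 0" and \<eta>: "\<eta> i = \<theta> i \<or> \<eta> i = - \<theta> i"
    and wM: "w i * (M i *v y)$1 + (M i *v y)$2 = cis (\<eta> i) * (w i * y$1 + y$2)"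
    and \<kappa>w: "\<kappa> i * (Im (w i) * y1) = y1 / a T" for i y y1
    using coord[of i] by (auto simp: coordinate_def)
  have indep: "rationally_independent (pi # map \<theta> [1..<Suc n])" if "n \<ge> 1" for n
  proof -
    have "[2..<Suc (Suc n)] = map Suc [1..<Suc n]" by (simp only: map_Suc_upt numeral_2_eq_2 One_nat_def)
    then have "map (\<lambda>i. quasi_momentum T a b (lam i)) [2..<Suc (Suc n)] = map \<theta> [1..<Suc n]"
      by (simp only: map_map) (simp add: \<theta>_def del: upt_Suc)
    then show ?thesis using assms(3)[of "Suc n"] that by (simp del: upt_Suc)
  qed
  have \<theta>0: "\<theta> 0 = of_rat (of_nat p / of_nat q) * pi" "\<theta> 0 \<noteq> pi / 2"
    using assms(7,8) by (simp_all add: \<theta>_def of_rat_divide)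
  note rotations = no_resonance[OF \<theta>(1) \<theta>(2) indep \<theta>0 \<eta>]
  \<comment> \<open>The \<open>k\<close>-th control value sits at the site \<open>Suc k * T\<close>, so the allowance \<open>K n / n\<close> at a site
      becomes \<open>H k / Suc k\<close> in terms of periods.\<close>
  define H where "H k = K (Suc k * T) / T" for k
  have H0: "H k > 0" for k unfolding H_def using assms(9)[of "Suc k * T"] T by simp
  have "k \<le> Suc k * T" for k using T by (cases T) auto
  then have "filterlim (\<lambda>k. Suc k * T) at_top sequentially"
    by (intro filterlim_at_top_mono[OF filterlim_ident] always_eventually) simp
  then have "filterlim (\<lambda>k. K (Suc k * T)) at_top sequentially"
    by (rule filterlim_compose[OF assms(10)])
  then have H: "filterlim H at_top sequentially"
    unfolding H_def divide_inverse
    by (rule filterlim_at_top_mult_tendsto_pos[OF tendsto_const, rotated]) (use T in simp)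
  obtain t where t: "\<And>k. \<bar>t k\<bar> \<le> H k / real (Suc k)" and
    decay: "\<And>i. \<exists>B. \<forall>z. z 0 = cis (\<eta> i) \<longrightarrow>
        (\<forall>k. z (Suc k) = cis (\<eta> i) * (z k - of_real (\<kappa> i * t k * Im (z k)))) \<longrightarrow>
        (\<forall>k. norm (z k) \<le> B / real (Suc k))"
    using simultaneous_decay_control[of \<kappa> "\<lambda>i. cis (\<eta> i)" \<eta> H, OF \<kappa> _ rotations H0 H] by auto
  define Q where "Q n = (if T dvd n then t (n div T - 1) else 0)" for n
  have Q0: "\<not> T dvd n \<Longrightarrow> Q n = 0" for n by (simp add: Q_def)
  have QT: "Q (Suc k * T) = t k" for k using T by (simp add: Q_def del: mult_Suc)
  have "\<bar>Q n\<bar> \<le> K n / real n" if "n \<ge> 1" for n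
  proof (cases "T dvd n")
    case True
    then obtain m where m: "n = T * m" by (elim dvdE)
    with that obtain k where "m = Suc k" by (cases m) auto
    with m have n: "n = Suc k * T" by simp
    have "H k / real (Suc k) = K n / real n" by (simp add: H_def n distrib_left mult.commute)
    then show ?thesis using t[of k] QT[of k] n by simp
  next
    case False
    then show ?thesis using assms(9)[OF that] by (simp add: Q0)
  qed
  moreover have "jacobi_solution T a b Q (lam (Suc i)) \<in> l2_seq" for i
  proof -
    define v where "v k = solution_vector T a b Q (lam (Suc i)) (k * T)" for k
    have vS: "v (Suc k) = M i *v v k - vector [0, t k / a T * (M i *v v k)$1]" for k
      using solution_vector_period[OF J, of Q v "lam (Suc i)" k, OF Q0 v_def]
      unfolding M_def QT .
    define z where "z k = w i * (M i *v v k)$1 + (M i *v v k)$2" for k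
    have zv: "z k = cis (\<eta> i) * (w i * (v k)$1 + (v k)$2)" for k
      unfolding z_def by (rule wM)
    have "z 0 = cis (\<eta> i)" by (simp add: zv v_def solution_vector_def)
    moreover have "z (Suc k) = cis (\<eta> i) * (z k - of_real (\<kappa> i * t k * Im (z k)))" for k
    proof -
      have "\<kappa> i * t k * Im (z k) = t k * (\<kappa> i * (Im (w i) * (M i *v v k)$1))"
        by (simp add: z_def)
      also have "\<dots> = t k / a T * (M i *v v k)$1" unfolding \<kappa>w by simp
      finally have e: "\<kappa> i * t k * Im (z k) = t k / a T * (M i *v v k)$1" .
      have c: "(v (Suc k))$1 = (M i *v v k)$1"
        "(v (Suc k))$2 = (M i *v v k)$2 - t k / a T * (M i *v v k)$1"
        using vS[of k] by simp_all
      show ?thesis unfolding zv[of "Suc k"] e c by (simp add: z_def)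
    qed
    ultimately obtain B where B: "\<And>k. norm (z k) \<le> B / real (Suc k)"
      using decay[of i] by blast
    define C where "C = 1 + (1 + norm (w i)) / \<bar>Im (w i)\<bar>"
    have C: "C \<ge> 0" by (simp add: C_def)
    have "norm (v k) \<le> C * B / real (Suc k)" for k
    proof -
      have "norm (v k) \<le> C * norm (z k)"
        using norm_le_coordinate[OF Im_w, of "v k" i] by (simp add: zv norm_mult C_def)
      also have "\<dots> \<le> C * (B / real (Suc k))" by (intro mult_left_mono B C)
      finally show ?thesis by simp
    qed
    then have "\<exists>B'. \<forall>n. \<bar>jacobi_solution T a b Q (lam (Suc i)) n\<bar> \<le> B' / real (Suc n)"
      unfolding v_def by (intro decay_between_periods[OF J Q0])
    then show ?thesis using l2_seq_of_inverse_decay by blast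
  qed
  ultimately show ?thesis
  proof (intro exI[of _ Q] conjI allI impI)
    fix i :: nat
    assume Q: "\<And>n. n \<ge> 1 \<Longrightarrow> \<bar>Q n\<bar> \<le> K n / real n"
      and l2: "\<And>i. jacobi_solution T a b Q (lam (Suc i)) \<in> l2_seq" and "i \<ge> 1"
    then obtain j where i: "i = Suc j" by (cases i) auto
    show "\<exists>u\<in>l2_seq. (\<exists>n\<ge>1. u n \<noteq> 0) \<and>
        (\<forall>n\<ge>1. jacobi_op a b u n + diag_op Q u n = lam i * u n)"
    proof (rule bexI[of _ "jacobi_solution T a b Q (lam i)"])
      show "(\<exists>n\<ge>1. jacobi_solution T a b Q (lam i) n \<noteq> 0) \<and>
          (\<forall>n\<ge>1. jacobi_op a b (jacobi_solution T a b Q (lam i)) n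
              + diag_op Q (jacobi_solution T a b Q (lam i)) n
            = lam i * jacobi_solution T a b Q (lam i) n)"
        using jacobi_solution_eigen_equation[OF J] by (intro conjI exI[of _ 1]) auto
    qed (use l2 i in simp)
  qed
qed

end
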